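(* Let $n\ge2$ and let $\beta\in(0,1)$. Let $B\in C^{3,\beta}_{\rm loc}((0,+\infty))\cap C^1([0,+\infty))$ satisfy $B(0)=B'(0)=0$ and $B(t),B'(t),B''(t)>0$ for all $t>0$. Let $H:\mathbb{R}^n\to\mathbb{R}$ be positive homogeneous of degree $1$, of class $C^{3,\beta}_{\rm loc}(\mathbb{R}^n\setminus\{0\})$, with $H(\xi)>0$ for all $\xi\ne0$. Assume that $B\circ H\in C^{3,\beta}_{\rm loc}(\mathbb{R}^n)$ and that for every $K>0$ there exists $\gamma>0$ such that $$\sum_{i,j=1}^n[\mathrm{Hess}(B\circ H)(\xi)]_{ij}\,\zeta_i\zeta_j\ge\gamma|\zeta|^2\qquad\text{for all }\xi,\zeta\in\mathbb{R}^n\text{ with }|\xi|\le K.$$ Then there exists a symmetric positive definite matrix $M\in\mathrm{Mat}_n(\mathbb{R})$ such that $$H(\xi)=\sqrt{\langle M\xi,\xi\rangle}\qquad\text{for all }\xi\in\mathbb{R}^n.$$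
   Context: Positive homogeneous of degree $1$ means $H(t\xi)=tH(\xi)$ for all $t>0$ and all $\xi$; in particular $H(0)=0$. No evenness of $H$ is assumed. *)

theory Defs
  imports "HOL-Analysis.Analysis"
begin

definition partial_deriv :: "'a::euclidean_space \<Rightarrow> ('a \<Rightarrow> real) \<Rightarrow> 'a \<Rightarrow> real" where
  "partial_deriv b f x = frechet_derivative f (at x) b"

primrec iter_partial :: "'a::euclidean_space list \<Rightarrow> ('a \<Rightarrow> real) \<Rightarrow> 'a \<Rightarrow> real" where
  "iter_partial [] f = f"
| "iter_partial (b # bs) f = partial_deriv b (iter_partial bs f)"

text \<open>Multi-indices are lists of basis vectors, so that the order of a partial derivative is the
  length of the list; for the type \<^typ>\<open>real\<close> the only basis vector is 1. The set \<open>S\<close> is meant to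
  be open in the following two definitions.\<close>

definition Ck_on :: "nat \<Rightarrow> ('a::euclidean_space \<Rightarrow> real) \<Rightarrow> 'a set \<Rightarrow> bool" where
  "Ck_on k f S \<longleftrightarrow>
     (\<forall>bs\<in>lists Basis. length bs < k \<longrightarrow> (\<forall>x\<in>S. iter_partial bs f differentiable (at x))) \<and>
     (\<forall>bs\<in>lists Basis. length bs \<le> k \<longrightarrow> continuous_on S (iter_partial bs f))"

definition holder_on :: "real \<Rightarrow> ('a::metric_space \<Rightarrow> real) \<Rightarrow> 'a set \<Rightarrow> bool" where
  "holder_on \<beta> f K \<longleftrightarrow> (\<exists>C. \<forall>x\<in>K. \<forall>y\<in>K. \<bar>f x - f y\<bar> \<le> C * dist x y powr \<beta>)"

definition Ck_holder_loc ::
  "nat \<Rightarrow> real \<Rightarrow> ('a::euclidean_space \<Rightarrow> real) \<Rightarrow> 'a set \<Rightarrow> bool" where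
  "Ck_holder_loc k \<beta> f S \<longleftrightarrow>
     Ck_on k f S \<and>
     (\<forall>bs\<in>lists Basis. length bs = k \<longrightarrow>
        (\<forall>K. compact K \<and> K \<subseteq> S \<longrightarrow> holder_on \<beta> (iter_partial bs f) K))"

text \<open>The derivative is taken within \<open>S\<close>, hence one-sided at an end point of an interval.\<close>

definition C1_within :: "(real \<Rightarrow> real) \<Rightarrow> real set \<Rightarrow> bool" where
  "C1_within f S \<longleftrightarrow>
     (\<forall>x\<in>S. f differentiable (at x within S)) \<and>
     continuous_on S (\<lambda>x. vector_derivative f (at x within S))"

definition Hess :: "(real ^ 'n \<Rightarrow> real) \<Rightarrow> real ^ 'n \<Rightarrow> real ^ 'n ^ 'n" where
  "Hess f x = (\<chi> i j. partial_deriv (axis i 1) (partial_deriv (axis j 1) f) x)"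

definition pos_homogeneous1 :: "('a::real_vector \<Rightarrow> real) \<Rightarrow> bool" where
  "pos_homogeneous1 H \<longleftrightarrow> (\<forall>t>0. \<forall>\<xi>. H (t *\<^sub>R \<xi>) = t * H \<xi>)"

definition sym_pos_def :: "real ^ 'n ^ 'n \<Rightarrow> bool" where
  "sym_pos_def M \<longleftrightarrow> transpose M = M \<and> (\<forall>x. x \<noteq> 0 \<longrightarrow> (M *v x) \<bullet> x > 0)"

end

theory Submission
  imports Defs
begin

text \<open>Put \<open>f = B \<circ> H\<close>. It is nonnegative and vanishes at 0, so its gradient vanishes there and
  \<open>f (t\<xi>) / t\<^sup>2\<close> tends to \<open>\<langle>Hess f(0) \<xi>, \<xi>\<rangle> / 2\<close> as \<open>t\<close> tends to 0 from the right. By homogeneity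
  \<open>f (t\<xi>) = B (t H(\<xi>))\<close>, so \<open>B(s) / s\<^sup>2\<close> has the limit \<open>\<langle>Hess f(0) \<xi>, \<xi>\<rangle> / (2 H(\<xi>)\<^sup>2)\<close> for every
  \<open>\<xi> \<noteq> 0\<close>; hence this quotient does not depend on \<open>\<xi>\<close>.\<close>

lemma Ck_on_differentiable:
  assumes "Ck_on k f S" "bs \<in> lists Basis" "length bs < k" "x \<in> S"
  shows "iter_partial bs f differentiable (at x)"
  using assms unfolding Ck_on_def by blast

text \<open>Chain rule with the differential expanded in the standard basis, because
  \<open>Hess\<close> is built from \<open>partial_deriv\<close>. It serves twice below: for the
  function itself, and for its first partial derivatives.\<close>

lemma has_real_derivative_along_line:
  fixes g :: "real ^ 'n \<Rightarrow> real"
  assumes "g differentiable (at (t *\<^sub>R \<xi>))"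
  shows "((\<lambda>s. g (s *\<^sub>R \<xi>)) has_real_derivative
           (\<Sum>i\<in>UNIV. \<xi> $ i * partial_deriv (axis i 1) g (t *\<^sub>R \<xi>))) (at t)"
proof -
  let ?D = "frechet_derivative g (at (t *\<^sub>R \<xi>))"
  have D: "(g has_derivative ?D) (at (t *\<^sub>R \<xi>))"
    using assms frechet_derivative_works by blast
  then have lin: "linear ?D"
    by (rule has_derivative_linear)
  have "((\<lambda>s. s *\<^sub>R \<xi>) has_derivative (\<lambda>s. s *\<^sub>R \<xi>)) (at t)"
    by (auto intro!: derivative_eq_intros)
  from has_derivative_compose[OF this D]
  have "((\<lambda>s. g (s *\<^sub>R \<xi>)) has_derivative (\<lambda>s. ?D (s *\<^sub>R \<xi>))) (at t)" .
  moreover have "(\<lambda>s. ?D (s *\<^sub>R \<xi>)) = (*) (?D \<xi>)"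
    using lin by (auto simp: linear_cmul)
  moreover have "?D \<xi> = (\<Sum>i\<in>UNIV. \<xi> $ i * partial_deriv (axis i 1) g (t *\<^sub>R \<xi>))"
  proof -
    have "\<xi> = (\<Sum>i\<in>UNIV. \<xi> $ i *\<^sub>R axis i 1)"
      using basis_expansion[of \<xi>] by (simp add: scalar_mult_eq_scaleR)
    then have "?D \<xi> = ?D (\<Sum>i\<in>UNIV. \<xi> $ i *\<^sub>R axis i 1)"
      by simp
    also have "\<dots> = (\<Sum>i\<in>UNIV. \<xi> $ i * ?D (axis i 1))"
      using lin by (simp add: linear_sum linear_cmul)
    finally show ?thesis
      by (simp add: partial_deriv_def)
  qed
  ultimately show ?thesis
    by (simp add: has_field_derivative_def)
qed

text \<open>One use of L'Hopital's rule leaves \<open>\<phi>' t / (2 * t)\<close>. Since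
  \<open>\<phi>' 0 = 0\<close>, this is half the difference quotient of \<open>\<phi>'\<close> at 0,
  so its limit is \<open>q / 2\<close> by the definition of the derivative.\<close>

lemma tendsto_second_order_quotient:
  fixes \<phi> \<phi>' :: "real \<Rightarrow> real"
  assumes \<phi>: "\<And>t. (\<phi> has_real_derivative \<phi>' t) (at t)"
    and \<phi>': "(\<phi>' has_real_derivative q) (at 0)"
    and zero: "\<phi> 0 = 0" "\<phi>' 0 = 0"
  shows "((\<lambda>t. \<phi> t / t\<^sup>2) \<longlongrightarrow> q / 2) (at_right 0)"
proof (rule lhopital_right_0[where f' = \<phi>' and g' = "\<lambda>t. 2 * t"])
  have "isCont \<phi> 0"
    using \<phi> DERIV_isCont by blast
  then show "(\<phi> \<longlongrightarrow> 0) (at_right 0)"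
    using zero(1) by (metis isCont_def filterlim_at_split)
  have "((\<lambda>t::real. t\<^sup>2) \<longlongrightarrow> 0\<^sup>2) (at_right 0)"
    by (intro tendsto_intros)
  then show "((\<lambda>t::real. t\<^sup>2) \<longlongrightarrow> 0) (at_right 0)"
    by simp
  show "\<forall>\<^sub>F t::real in at_right 0. t\<^sup>2 \<noteq> 0"
    by (auto simp: eventually_at_filter)
  show "\<forall>\<^sub>F t::real in at_right 0. 2 * t \<noteq> 0"
    by (auto simp: eventually_at_filter)
  show "\<forall>\<^sub>F t in at_right 0. (\<phi> has_real_derivative \<phi>' t) (at t)"
    using \<phi> by simp
  show "\<forall>\<^sub>F t::real in at_right 0. ((\<lambda>t. t\<^sup>2) has_real_derivative 2 * t) (at t)"
    by (rule always_eventually) (auto intro!: derivative_eq_intros)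
  have "((\<lambda>t. \<phi>' t / t) \<longlongrightarrow> q) (at 0)"
    using \<phi>' zero(2) by (simp add: DERIV_def)
  then have "((\<lambda>t. \<phi>' t / t) \<longlongrightarrow> q) (at_right 0)"
    by (simp add: filterlim_at_split)
  then have "((\<lambda>t. \<phi>' t / t / 2) \<longlongrightarrow> q / 2) (at_right 0)"
    by (intro tendsto_intros) auto
  then show "LIM t at_right 0. \<phi>' t / (2 * t) :> nhds (q / 2)"
    by (simp add: mult.commute)
qed

lemma C2_tendsto_half_Hess:
  fixes f :: "real ^ 'n \<Rightarrow> real"
  assumes f: "Ck_on k f UNIV" "2 \<le> k"
    and min: "f 0 = 0" "\<And>x. f x \<ge> 0"
  shows "((\<lambda>t. f (t *\<^sub>R \<xi>) / t\<^sup>2) \<longlongrightarrow>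
           (\<Sum>i\<in>UNIV. \<Sum>j\<in>UNIV. Hess f 0 $ i $ j * \<xi> $ i * \<xi> $ j) / 2) (at_right 0)"
proof -
  let ?g = "\<lambda>i. partial_deriv (axis i 1) f"
  define \<phi>' where "\<phi>' t = (\<Sum>i\<in>UNIV. \<xi> $ i * ?g i (t *\<^sub>R \<xi>))" for t
  have df: "f differentiable (at x)" for x
    using Ck_on_differentiable[OF f(1), of "[]"] f(2) by simp
  have dg: "?g i differentiable (at x)" for i x
    using Ck_on_differentiable[OF f(1), of "[axis i 1]"] f(2) by simp
  have \<phi>: "((\<lambda>t. f (t *\<^sub>R \<xi>)) has_real_derivative \<phi>' t) (at t)" for t
    unfolding \<phi>'_def by (rule has_real_derivative_along_line[OF df])
  have "(\<phi>' has_real_derivative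
          (\<Sum>i\<in>UNIV. \<xi> $ i * (\<Sum>j\<in>UNIV. \<xi> $ j * partial_deriv (axis j 1) (?g i) (0 *\<^sub>R \<xi>)))) (at 0)"
    unfolding \<phi>'_def by (intro DERIV_sum DERIV_cmult has_real_derivative_along_line dg)
  moreover have "(\<Sum>i\<in>UNIV. \<xi> $ i * (\<Sum>j\<in>UNIV. \<xi> $ j * partial_deriv (axis j 1) (?g i) (0 *\<^sub>R \<xi>)))
      = (\<Sum>i\<in>UNIV. \<Sum>j\<in>UNIV. Hess f 0 $ i $ j * \<xi> $ i * \<xi> $ j)"
    \<comment> \<open>Differentiating \<open>\<phi>'\<close> gives the mixed partials with the
      indices in the order opposite to that in \<open>Hess\<close>; exchanging the two sums realigns
      them.\<close>
    unfolding Hess_def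
    by (rule trans[OF _ sum.swap]) (simp add: sum_distrib_left mult_ac)
  ultimately have \<phi>'': "(\<phi>' has_real_derivative
      (\<Sum>i\<in>UNIV. \<Sum>j\<in>UNIV. Hess f 0 $ i $ j * \<xi> $ i * \<xi> $ j)) (at 0)"
    by simp
  have "\<phi>' 0 = 0"
    \<comment> \<open>The minimum at 0 is global, so the radius 1 of the neighbourhood is
      arbitrary.\<close>
    using DERIV_local_min[OF \<phi>[of 0], of 1] min by simp
  with \<phi> \<phi>'' min(1) show ?thesis
    by (intro tendsto_second_order_quotient[where \<phi>' = \<phi>']) auto
qed

text \<open>A matrix and its transpose have the same quadratic form. Averaging them therefore yields
  a matrix that is symmetric by construction and still represents the Hessian form.\<close>

lemma sum_quadratic_form_eq_sym:
  fixes A :: "real ^ 'n ^ 'n"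
  shows "((c *\<^sub>R (A + transpose A)) *v x) \<bullet> x
    = 2 * c * (\<Sum>i\<in>UNIV. \<Sum>j\<in>UNIV. A $ i $ j * x $ i * x $ j)"
proof -
  have A: "(A *v x) \<bullet> x = (\<Sum>i\<in>UNIV. \<Sum>j\<in>UNIV. A $ i $ j * x $ i * x $ j)"
    by (simp add: inner_vec_def matrix_vector_mult_def sum_distrib_right sum_distrib_left mult_ac)
  have "(transpose A *v x) \<bullet> x = (A *v x) \<bullet> x"
    by (metis dot_lmul_matrix inner_commute transpose_matrix_vector)
  then have "((c *\<^sub>R (A + transpose A)) *v x) \<bullet> x = 2 * c * ((A *v x) \<bullet> x)"
    by (simp add: scaleR_matrix_vector_assoc[symmetric] matrix_vector_mult_add_rdistrib
        inner_add_left)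
  then show ?thesis
    using A by simp
qed

theorem mainTheorem7:
  fixes \<beta> :: real and B :: "real \<Rightarrow> real" and H :: "real ^ 'n \<Rightarrow> real"
  assumes "CARD('n) \<ge> 2"
    and "0 < \<beta>" and "\<beta> < 1"
    and "Ck_holder_loc 3 \<beta> B {0<..}"
    and "C1_within B {0..}"
    and "B 0 = 0" and "vector_derivative B (at 0 within {0..}) = 0"
    and "\<And>t. t > 0 \<Longrightarrow> B t > 0 \<and> deriv B t > 0 \<and> deriv (deriv B) t > 0"
    and "pos_homogeneous1 H"
    and "Ck_holder_loc 3 \<beta> H (UNIV - {0})"
    and "\<And>\<xi>. \<xi> \<noteq> 0 \<Longrightarrow> H \<xi> > 0"
    and "Ck_holder_loc 3 \<beta> (B \<circ> H) UNIV"
    and "\<And>K. K > 0 \<Longrightarrow> \<exists>\<gamma>>0. \<forall>\<xi> \<zeta>. norm \<xi> \<le> K \<longrightarrow>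
           (\<Sum>i\<in>UNIV. \<Sum>j\<in>UNIV. Hess (B \<circ> H) \<xi> $ i $ j * \<zeta> $ i * \<zeta> $ j) \<ge> \<gamma> * (norm \<zeta>)\<^sup>2"
  shows "\<exists>M :: real ^ 'n ^ 'n. sym_pos_def M \<and> (\<forall>\<xi>. H \<xi> = sqrt ((M *v \<xi>) \<bullet> \<xi>))"
proof -
  let ?f = "B \<circ> H"
  define Q where "Q \<xi> = (\<Sum>i\<in>UNIV. \<Sum>j\<in>UNIV. Hess ?f 0 $ i $ j * \<xi> $ i * \<xi> $ j)" for \<xi>
  note Bpos = assms(8) and Hpos = assms(11)
  have hom: "H (t *\<^sub>R \<xi>) = t * H \<xi>" if "t > 0" for t \<xi>
    using assms(9) that by (simp add: pos_homogeneous1_def)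
  have H0: "H 0 = 0"
    \<comment> \<open>Homogeneity at the origin with factor 2 reads H(0) = 2 H(0).\<close>
    using hom[of 2 0] by simp
  have f0: "?f 0 = 0"
    using H0 assms(6) by simp
  have fnn: "?f \<xi> \<ge> 0" for \<xi>
    using f0 Bpos Hpos[of \<xi>] by (cases "\<xi> = 0") (auto intro: less_imp_le)
  have lim_f: "((\<lambda>t. ?f (t *\<^sub>R \<xi>) / t\<^sup>2) \<longlongrightarrow> Q \<xi> / 2) (at_right 0)" for \<xi>
    unfolding Q_def using assms(12) f0 fnn
    by (intro C2_tendsto_half_Hess[where k = 3]) (auto simp: Ck_holder_loc_def simp del: o_apply)
  have lim_B: "((\<lambda>s. B s / s\<^sup>2) \<longlongrightarrow> Q \<xi> / (2 * (H \<xi>)\<^sup>2)) (at_right 0)" if "\<xi> \<noteq> 0" for \<xi>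
  proof -
    let ?h = "H \<xi>"
    have h: "?h > 0"
      using Hpos that by blast
    \<comment> \<open>Substitute t = s / H(\<xi>), which stays positive as s tends to 0 from the
      right. Homogeneity turns f(t\<xi>) into B(s), and the further division by H(\<xi>)^2 turns the
      denominator t^2 into s^2.\<close>
    have "filterlim (\<lambda>s. s / ?h) (at_right 0) (at_right 0)"
    proof -
      have "((\<lambda>s. s / ?h) \<longlongrightarrow> 0 / ?h) (at_right 0)"
        using h by (intro tendsto_intros) auto
      then show ?thesis
        using h by (auto simp: filterlim_at eventually_at_filter)
    qed
    from filterlim_compose[OF lim_f[of \<xi>] this]
    have "((\<lambda>s. ?f ((s / ?h) *\<^sub>R \<xi>) / (s / ?h)\<^sup>2 / ?h\<^sup>2) \<longlongrightarrow> Q \<xi> / 2 / ?h\<^sup>2) (at_right 0)"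
      by (rule tendsto_divide[OF _ tendsto_const]) (use h in simp)
    moreover have "\<forall>\<^sub>F s in at_right 0. ?f ((s / ?h) *\<^sub>R \<xi>) / (s / ?h)\<^sup>2 / ?h\<^sup>2 = B s / s\<^sup>2"
      using h hom[of _ \<xi>] by (auto simp: eventually_at_filter power_divide)
    ultimately show ?thesis
      by (simp add: filterlim_cong)
  qed
  \<comment> \<open>The bound is used only at the point 0, so any radius would do in place of
    1.\<close>
  obtain \<gamma> where \<gamma>: "\<gamma> > 0" "\<And>\<xi> \<zeta>. norm \<xi> \<le> 1 \<Longrightarrow>
      (\<Sum>i\<in>UNIV. \<Sum>j\<in>UNIV. Hess ?f \<xi> $ i $ j * \<zeta> $ i * \<zeta> $ j) \<ge> \<gamma> * (norm \<zeta>)\<^sup>2"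
    using assms(13)[of 1] by auto
  have Qpos: "Q \<zeta> > 0" if "\<zeta> \<noteq> 0" for \<zeta>
  proof -
    have "0 < \<gamma> * (norm \<zeta>)\<^sup>2"
      using \<gamma>(1) that by simp
    also have "\<dots> \<le> Q \<zeta>"
      unfolding Q_def using \<gamma>(2)[of 0 \<zeta>] by simp
    finally show ?thesis .
  qed
  \<comment> \<open>Any nonzero reference vector serves, hence the unspecified index. The constant
    \<open>q\<close> is twice the limit of B(s) / s^2, computed along \<open>e\<close>; uniqueness
    of that limit then gives Q(\<xi>) = q H(\<xi>)^2 for every nonzero \<xi>.\<close>
  define e :: "real ^ 'n" where "e = axis undefined 1"
  define q where "q = Q e / (H e)\<^sup>2"
  have e: "e \<noteq> 0"
    by (simp add: e_def axis_eq_0_iff)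
  have q: "q > 0"
    using Qpos[OF e] Hpos[OF e] by (simp add: q_def)
  have Q: "Q \<xi> / q = (H \<xi>)\<^sup>2" if "\<xi> \<noteq> 0" for \<xi>
  proof -
    have "Q \<xi> / (2 * (H \<xi>)\<^sup>2) = Q e / (2 * (H e)\<^sup>2)"
      by (rule tendsto_unique[OF _ lim_B[OF that] lim_B[OF e]]) simp
    then have "Q \<xi> / (H \<xi>)\<^sup>2 = q"
      by (simp add: q_def)
    then show ?thesis
      using q Hpos[OF that] by (auto simp: field_simps)
  qed
  \<comment> \<open>The factor 1/2 averages the Hessian with its transpose, and 1/q scales its form
    from q H^2 to H^2.\<close>
  define M where "M = (1 / (2 * q)) *\<^sub>R (Hess ?f 0 + transpose (Hess ?f 0))"
  have M: "(M *v \<xi>) \<bullet> \<xi> = Q \<xi> / q" for \<xi>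
    unfolding M_def sum_quadratic_form_eq_sym Q_def by simp
  have "transpose M = M"
    by (simp add: M_def transpose_def vec_eq_iff add.commute)
  then have "sym_pos_def M"
    using Qpos q by (simp add: sym_pos_def_def M)
  moreover have "H \<xi> = sqrt ((M *v \<xi>) \<bullet> \<xi>)" for \<xi>
  proof (cases "\<xi> = 0")
    case True
    then show ?thesis
      using H0 by simp
  next
    case False
    \<comment> \<open>Positivity of H(\<xi>) selects the right root of H(\<xi>)^2.\<close>
    then show ?thesis
      using Q Hpos[OF False] by (simp add: M)
  qed
  ultimately show ?thesis
    by blast
qed

end
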